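(* Let $(C_1,C_2)$ be a double-chain whose points are colored black and white, where the colors of the points of $C_1$, read from left to right, are periodic with the following period of length $16$: $2$ black, $4$ white, $6$ black and $4$ white points (the points of $C_2$ colored arbitrarily). If $|C_1|\ge 28(|C_2|+1)$, then $(C_1,C_2)$ has no non-crossing Hamiltonian alternating path.
   Context: A convex (resp. concave) chain is a finite set of points in the plane lying on the graph of a strictly convex (resp. strictly concave) function. A double-chain $(C_1,C_2)$ consists of a convex chain $C_1$ and a concave chain $C_2$ such that every point of $C_2$ lies strictly below every line determined by two points of $C_1$, and every point of $C_1$ lies strictly above every line determined by two points of $C_2$. Points of each chain are ordered by $x$-coordinate. A non-crossing Hamiltonian alternating path on a $2$-colored point set is a path visiting every point exactly once, drawn with straight-line segments no two of which cross, and whose consecutive vertices have different colors. *)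

theory Defs
  imports "HOL-Analysis.Analysis"
begin

type_synonym point = "real \<times> real"

datatype color = Black | White

definition strictly_convex :: "(real \<Rightarrow> real) \<Rightarrow> bool" where
  "strictly_convex f \<longleftrightarrow>
     (\<forall>x y t. x \<noteq> y \<and> 0 < t \<and> t < 1 \<longrightarrow>
        f ((1 - t) * x + t * y) < (1 - t) * f x + t * f y)"

definition strictly_concave :: "(real \<Rightarrow> real) \<Rightarrow> bool" where
  "strictly_concave f \<longleftrightarrow> strictly_convex (\<lambda>x. - f x)"

definition convex_chain :: "point set \<Rightarrow> bool" where
  "convex_chain C \<longleftrightarrow>
     finite C \<and> (\<exists>f. strictly_convex f \<and> (\<forall>p\<in>C. snd p = f (fst p)))"

definition concave_chain :: "point set \<Rightarrow> bool" where
  "concave_chain C \<longleftrightarrow>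
     finite C \<and> (\<exists>f. strictly_concave f \<and> (\<forall>p\<in>C. snd p = f (fst p)))"

text \<open>
  The line through two distinct points is the affine hull of the pair. The points of a chain
  have distinct x-coordinates, so the lines considered below are never vertical and
  exactly one point of the line lies on the vertical through \<open>p\<close>.
\<close>

definition strictly_below :: "point \<Rightarrow> point set \<Rightarrow> bool" where
  "strictly_below p L \<longleftrightarrow> (\<exists>y. (fst p, y) \<in> L \<and> snd p < y)"

definition strictly_above :: "point \<Rightarrow> point set \<Rightarrow> bool" where
  "strictly_above p L \<longleftrightarrow> (\<exists>y. (fst p, y) \<in> L \<and> y < snd p)"

definition double_chain :: "point set \<Rightarrow> point set \<Rightarrow> bool" where
  "double_chain C1 C2 \<longleftrightarrow>
     convex_chain C1 \<and> concave_chain C2 \<and>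
     (\<forall>p\<in>C2. \<forall>a\<in>C1. \<forall>b\<in>C1. a \<noteq> b \<longrightarrow> strictly_below p (affine hull {a, b})) \<and>
     (\<forall>p\<in>C1. \<forall>a\<in>C2. \<forall>b\<in>C2. a \<noteq> b \<longrightarrow> strictly_above p (affine hull {a, b}))"

definition left_to_right :: "point set \<Rightarrow> point list" where
  "left_to_right C = sorted_key_list_of_set fst C"

text \<open>
  The sequence starts at the beginning of a period; the last period may be incomplete.
\<close>

definition periodic_with :: "'a list \<Rightarrow> 'a list \<Rightarrow> bool" where
  "periodic_with w xs \<longleftrightarrow> (\<forall>i<length xs. xs ! i = w ! (i mod length w))"

definition color_period :: "color list" where
  "color_period =
     replicate 2 Black @ replicate 4 White @ replicate 6 Black @ replicate 4 White"

text \<open>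
  No three points of a double-chain are collinear, so in it two distinct edges cross in this
  sense if and only if they have a common point that is not an endpoint of both.
\<close>

definition segments_cross :: "point \<times> point \<Rightarrow> point \<times> point \<Rightarrow> bool" where
  "segments_cross e e' \<longleftrightarrow>
     open_segment (fst e) (snd e) \<inter> open_segment (fst e') (snd e') \<noteq> {}"

definition path_edge :: "point list \<Rightarrow> nat \<Rightarrow> point \<times> point" where
  "path_edge ps i = (ps ! i, ps ! Suc i)"

definition noncrossing_path :: "point list \<Rightarrow> bool" where
  "noncrossing_path ps \<longleftrightarrow>
     (\<forall>i j. i < j \<and> Suc j < length ps \<longrightarrow>
        \<not> segments_cross (path_edge ps i) (path_edge ps j))"

definition noncrossing_hamiltonian_alternating_path ::
    "(point \<Rightarrow> color) \<Rightarrow> point set \<Rightarrow> point list \<Rightarrow> bool" where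
  "noncrossing_hamiltonian_alternating_path col P ps \<longleftrightarrow>
     distinct ps \<and> set ps = P \<and>
     successively (\<lambda>p q. col p \<noteq> col q) ps \<and>
     noncrossing_path ps"

end

theory Submission
  imports Defs
begin

text \<open>
  Deleting \<open>C2\<close> from a Hamiltonian path leaves at most \<open>card C2 + 1\<close> paths that cover \<open>C1\<close>. As
  \<open>C1\<close> is in convex position, these paths form a noncrossing forest with alternating colors
  and degrees at most 2 on the numbers below \<open>n = card C1\<close>, with at least \<open>n - card C2 - 1\<close> edges.
  Such a forest consists of at least \<open>n / 24\<close> paths.

  For this bound give every vertex two slots, one per possible edge. On an interval \<open>[t, u)\<close>
  of slots, the quantity \<open>24 * (number of unused slots) - (u - t)\<close> has a lower bound that depends
  only on \<open>t\<close> and \<open>u\<close> modulo 32, because there are three ways to reduce an interval: its first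
  slot is unused, it splits in two, or one edge joins its first and its last slot. In the last
  case, if both end vertices lie completely in the interval, then acyclicity forces the inside
  to split at a gap between two vertices. Without that refinement, closed cycles would
  make the resulting bound too weak.
\<close>

section \<open>Bounds for intervals of slots\<close>

text \<open>
  The entry in row \<open>t\<close> and column \<open>u\<close> bounds the intervals \<open>[t, u)\<close> modulo 32. The table is the
  largest one compatible with the three reductions, computed like all-pairs shortest paths,
  starting from the value 23 of an unused slot. It need not be trusted: only the inequalities
  checked below matter.
\<close>

definition slot_table :: "int list list" where
  "slot_table = [
   [0, 23, 30, 37, 28, 35, 26, 17, 40, 15, 38, 29, 52, 27, 34, 41,
    32, 39, 30, 37, 44, 35, 42, 33, 40, 31, 38, 13, 36, 11, 34, 25],
   [25, 0, 23, 30, 37, 28, 19, 42, 17, 24, 31, 22, 29, 20, 43, 34,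
    41, 32, 39, 30, 37, 44, 35, 42, 49, 40, 15, 38, 13, 20, 27, 18],
   [18, 25, 0, 23, 30, 21, 44, 19, 26, 33, 24, 31, 22, 29, 52, 43,
    34, 41, 32, 39, 30, 37, 44, 35, 42, 17, 40, 15, 22, 29, 20, 27],
   [27, 18, 25, 0, 23, -2, 21, 28, 35, 26, 33, 24, 31, 22, 29, 20,
    27, 34, 9, 32, 7, 14, 21, 12, 19, 10, 17, 24, 31, 22, 29, 20],
   [36, 27, 18, 25, 0, 23, 30, 37, 28, 35, 26, 33, 40, 31, 22, 29,
    52, 27, 34, 9, 32, 7, 30, 21, 44, 19, 26, 33, 24, 31, 22, 29],
   [29, 20, 27, 18, 25, 0, 23, 30, 37, 28, 51, 26, 33, 24, 31, 22,
    29, 36, 11, 34, 9, 16, 23, 14, 21, 12, 35, 26, 33, 24, 47, 22],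
   [22, 29, 20, 27, 34, 25, 0, 23, 30, 37, 28, 51, 26, 33, 24, 31,
    38, 13, 36, 11, 18, 25, 16, 23, 30, 21, 44, 35, 26, 33, 24, 47],
   [31, 22, 29, 20, 11, 18, 41, 0, 23, 30, 37, 28, 35, 26, 33, 24,
    15, 38, 13, 20, 27, 18, 25, 16, 23, 14, 37, 44, 35, 26, 33, 24],
   [24, 31, 22, 13, 36, 11, 34, 41, 0, 23, 30, 37, 28, 35, 26, 17,
    40, 15, 22, 29, 20, 27, 18, 25, 32, 23, 30, 37, 44, 35, 26, 33],
   [33, 24, 15, 38, 13, 36, 43, 34, 41, 0, 23, 30, 37, 28, 19, 42,
    17, 40, 31, 22, 45, 20, 27, 34, 25, 32, 39, 30, 37, 44, 35, 26],
   [26, 17, 40, 15, 38, 13, 36, 43, 34, 41, 0, 23, 30, 21, 44, 19,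
    42, 33, 24, 47, 22, 29, 36, 27, 34, 25, 32, 39, 30, 37, 44, 35],
   [19, 10, 17, 40, 31, 38, 29, 36, 27, 18, 25, 0, 23, -2, 21, 44,
    35, 42, 49, 40, 47, 38, 45, 52, 43, 34, 25, 32, 23, 14, 21, 12],
   [44, 19, 42, 49, 40, 31, 38, 29, 36, 27, 34, 25, 0, 23, 46, 53,
    44, 51, 42, 49, 40, 47, 54, 45, 52, 43, 34, 25, 32, 23, 30, 21],
   [21, 12, 35, 42, 33, 40, 31, 38, 29, 20, 27, 18, 25, 0, 23, 46,
    37, 44, 51, 42, 49, 40, 47, 54, 45, 52, 27, 34, 25, 16, 23, 14],
   [30, 21, 44, 35, 42, 33, 40, 31, 22, 29, 20, 27, 34, 25, 0, 23,
    46, 37, 44, 51, 42, 49, 40, 47, 54, 45, 36, 27, 18, 25, 16, 23],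
   [7, 14, 37, 44, 35, 42, 33, 24, 31, 22, 29, 20, 11, 18, 41, 0,
    23, 46, 37, 44, 51, 42, 49, 40, 47, 38, 29, 20, 27, 18, 25, 16],
   [32, 7, 30, 37, 44, 35, 26, 33, 24, 31, 22, 13, 36, 11, 34, 41,
    0, 23, 46, 37, 44, 51, 42, 49, 40, 47, 22, 45, 20, 27, 18, 9],
   [9, 32, 39, 30, 37, 28, 35, 26, 33, 24, 15, 38, 13, 36, 43, 34,
    41, 0, 23, 46, 37, 44, 51, 42, 49, 40, 47, 22, 29, 20, 11, 34],
   [34, 9, 32, 39, 30, 37, 28, 35, 26, 17, 40, 15, 38, 13, 36, 43,
    34, 41, 0, 23, 46, 37, 44, 51, 42, 49, 24, 31, 22, 13, 36, 11],
   [27, 34, 41, 32, 39, 30, 37, 28, 19, 42, 17, 40, 31, 38, 45, 36,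
    43, 34, 41, 0, 23, 46, 37, 44, 51, 42, 33, 40, 15, 38, 13, 36],
   [52, 27, 34, 41, 32, 39, 30, 21, 44, 19, 42, 33, 56, 31, 38, 45,
    36, 43, 34, 41, 0, 23, 46, 37, 44, 35, 42, 17, 40, 15, 38, 29],
   [29, 20, 43, 34, 41, 32, 23, 46, 21, 28, 35, 26, 33, 24, 47, 38,
    45, 36, 43, 34, 41, 0, 23, 46, 53, 44, 19, 42, 17, 24, 31, 22],
   [22, 29, 52, 43, 34, 25, 48, 23, 30, 37, 28, 35, 26, 33, 56, 47,
    38, 45, 36, 43, 34, 41, 0, 23, 46, 21, 44, 19, 26, 33, 24, 31],
   [31, 22, 29, 20, 27, 18, 25, 32, 39, 30, 37, 28, 35, 26, 33, 24,
    31, 38, 13, 36, 11, 18, 25, 0, 23, -2, 21, 28, 35, 26, 33, 24],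
   [40, 31, 22, 29, 52, 27, 34, 41, 32, 39, 30, 37, 44, 35, 26, 33,
    56, 31, 38, 13, 36, 11, 34, 25, 0, 23, 30, 37, 28, 35, 26, 33],
   [33, 24, 31, 22, 29, 20, 43, 34, 41, 32, 55, 30, 37, 28, 35, 26,
    33, 40, 15, 38, 13, 20, 27, 18, 25, 0, 23, 30, 37, 28, 51, 26],
   [26, 33, 24, 31, 38, 29, 52, 43, 34, 41, 32, 55, 30, 37, 28, 35,
    42, 17, 40, 15, 22, 29, 20, 27, 34, 25, 0, 23, 30, 37, 28, 51],
   [35, 26, 33, 24, 15, 22, 45, 52, 43, 34, 41, 32, 39, 30, 37, 28,
    19, 42, 17, 24, 31, 22, 29, 20, 27, 18, 41, 0, 23, 30, 37, 28],
   [28, 35, 26, 17, 40, 15, 38, 45, 52, 43, 34, 41, 32, 39, 30, 21,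
    44, 19, 26, 33, 24, 31, 22, 29, 36, 27, 34, 41, 0, 23, 30, 37],
   [37, 28, 19, 42, 17, 40, 47, 38, 45, 52, 43, 34, 41, 32, 23, 46,
    21, 28, 35, 26, 33, 24, 31, 38, 29, 36, 43, 34, 41, 0, 23, 30],
   [30, 21, 44, 19, 26, 17, 40, 47, 38, 45, 52, 43, 34, 25, 48, 23,
    30, 37, 28, 35, 26, 33, 40, 31, 38, 29, 36, 43, 34, 41, 0, 23],
   [23, -2, 21, 28, 35, 26, 17, 40, 15, 22, 29, 20, 27, 18, 25, 32,
    39, 30, 37, 28, 35, 42, 33, 40, 31, 38, 13, 36, 11, 18, 25, 0]
  ]"

section \<open>Checks of the table by evaluation: base values, splits, and the two kinds of
  edges\<close>

definition slots :: "(color \<times> bool) list" where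
  "slots = concat (map (\<lambda>c. [(c, True), (c, False)]) color_period)"

text \<open>The sign of the first row yields the final estimate, because the interval of all slots
  starts at slot 0.\<close>

lemma slot_table_shape_code:
  "length slot_table = 32 \<and> list_all (\<lambda>r. length r = 32) slot_table \<and> list_all (\<lambda>x. 0 \<le> x) (hd slot_table)"
  by code_simp

lemma slot_table_step_code:
  "list_all (\<lambda>(i, r). r ! (Suc i mod 32) \<le> 23 \<and> r ! i = 0) (zip [0..<32] slot_table)"
  by code_simp

text \<open>The bounded quantity is additive when an interval is cut in two, so the table has to be
  subadditive.\<close>

lemma slot_table_triangle_code:
  "list_all (\<lambda>r. list_all (\<lambda>(x, r'). list_all2 (\<lambda>z y. z \<le> x + y) r r') (zip r slot_table)) slot_table"
  by code_simp

lemma slot_table_edge_code: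
  "list_all (\<lambda>((a, e), r, r').
     list_all (\<lambda>((b, e'), x, z). a = b \<or> e \<and> \<not> e' \<or> x \<le> z - 2) (zip slots (zip (rotate1 r) r')))
   (zip slots (zip slot_table (rotate1 slot_table)))"
  by code_simp

fun evens :: "'a list \<Rightarrow> 'a list" where
  "evens (x # y # xs) = x # evens xs"
| "evens xs = xs"

definition odds :: "'a list \<Rightarrow> 'a list" where
  "odds xs = evens (tl xs)"

lemma evens_length: "length (evens xs) = (length xs + 1) div 2"
  by (induction xs rule: evens.induct) auto

lemma evens_nth: "2 * i < length xs \<Longrightarrow> evens xs ! i = xs ! (2 * i)"
  by (induction xs arbitrary: i rule: evens.induct) (auto simp: nth_Cons' mult_2)

lemma odds_length: "length (odds xs) = length xs div 2"
  by (cases xs) (auto simp: odds_def evens_length)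

lemma odds_nth: "2 * i + 1 < length xs \<Longrightarrow> odds xs ! i = xs ! (2 * i + 1)"
  by (cases xs) (auto simp: odds_def evens_nth)

text \<open>This treats the pairs exempted in \<open>slot_table_edge_code\<close> for starting at a
  first slot and ending at a second slot. \<open>evens\<close> and \<open>odds\<close> select the
  first and the second slots of the vertices: \<open>q\<close> ends and \<open>z\<close> starts at
  the first slot of the vertex after the gap.\<close>

lemma slot_table_close_code:
  "list_all (\<lambda>(a, r, r').
     list_all (\<lambda>(q, r''). list_all (\<lambda>(b, x, z). a = b \<or> x \<le> q + z - 2) (zip color_period (zip r r'')))
       (zip r' (map odds (evens slot_table))))
   (zip color_period (zip (map (odds \<circ> rotate1) (evens slot_table)) (map evens (odds slot_table))))"
  by code_simp

lemma slots_code: "slots = map (\<lambda>t. (color_period ! (t div 2), even t)) [0..<32]"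
  by code_simp

section \<open>The table as a periodic function of arbitrary slots: 16 colors with two slots each
  give period 32\<close>

definition slot_bound :: "nat \<Rightarrow> nat \<Rightarrow> int" where
  "slot_bound t u = slot_table ! (t mod 32) ! (u mod 32)"

definition period_color :: "nat \<Rightarrow> color" where
  "period_color v = color_period ! (v mod 16)"

lemma length_slot_table: "length slot_table = 32"
  using slot_table_shape_code by blast

lemma length_slot_table_row: "t < 32 \<Longrightarrow> length (slot_table ! t) = 32"
  using slot_table_shape_code by (simp add: list_all_length)

lemma length_color_period: "length color_period = 16"
  by (simp add: color_period_def)

lemma length_slots: "length slots = 32"
  by (simp add: slots_code)

lemma slot_mod: "t mod 32 = 2 * (t div 2 mod 16) + t mod (2::nat)"
  using mod_mult2_eq[of t 2 16] by simp

lemma slots_nth: "slots ! (t mod 32) = (period_color (t div 2), even t)"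
proof -
  have "t mod 32 div 2 = t div 2 mod 16" "even (t mod 32) = even t"
    unfolding slot_mod[of t] by simp_all
  then show ?thesis
    by (simp add: slots_code period_color_def)
qed

lemma rotate1_slot_table_nth: "rotate1 slot_table ! (t mod 32) = slot_table ! (Suc t mod 32)"
  by (simp add: nth_rotate1 length_slot_table mod_Suc_eq)

lemma rotate1_slot_table_row_nth:
  "rotate1 (slot_table ! (t mod 32)) ! (v mod 32) = slot_bound t (Suc v)"
  by (simp add: nth_rotate1 length_slot_table_row mod_Suc_eq slot_bound_def)

lemmas slot_table_lengths = length_slot_table length_slot_table_row length_slots

lemma list_all_zipD:
  "list_all P (zip xs ys) \<Longrightarrow> i < length xs \<Longrightarrow> i < length ys \<Longrightarrow> P (xs ! i, ys ! i)"
  by (auto simp: list_all_length)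

lemma slot_bound_start: "0 \<le> slot_bound 0 u"
proof -
  have "hd slot_table = slot_table ! 0"
    using length_slot_table by (intro hd_conv_nth) auto
  then show ?thesis
    using slot_table_shape_code by (auto simp: list_all_length slot_bound_def)
qed

lemma slot_bound_step: "slot_bound t (Suc t) \<le> 23" and slot_bound_refl: "slot_bound t t = 0"
  using list_all_zipD[OF slot_table_step_code, of "t mod 32"]
  by (auto simp: slot_table_lengths slot_bound_def mod_Suc_eq)

lemma slot_bound_triangle: "slot_bound t u \<le> slot_bound t y + slot_bound y u"
proof -
  let ?t = "t mod 32" and ?y = "y mod 32" and ?u = "u mod 32"
  have "list_all (\<lambda>(x, r'). list_all2 (\<lambda>z y. z \<le> x + y) (slot_table ! ?t) r') (zip (slot_table ! ?t) slot_table)"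
    using slot_table_triangle_code by (simp add: list_all_length slot_table_lengths)
  from list_all_zipD[OF this, of ?y]
  have "list_all2 (\<lambda>z w. z \<le> slot_bound t y + w) (slot_table ! ?t) (slot_table ! ?y)"
    by (simp add: slot_table_lengths slot_bound_def)
  from list_all2_nthD[OF this, of ?u] show ?thesis
    by (simp add: slot_table_lengths slot_bound_def)
qed

text \<open>If \<open>t\<close> is odd, the first vertex of the interval is only half inside; if
  \<open>v\<close> is even, the last one is. The gap between components may then sit at an end of
  the inner interval, so no split is demanded.\<close>

lemma slot_bound_edge:
  assumes "period_color (t div 2) \<noteq> period_color (v div 2)" "odd t \<or> even v"
  shows "slot_bound t (Suc v) \<le> slot_bound (Suc t) v - 2"
proof -
  let ?t = "t mod 32" and ?v = "v mod 32"
  have "list_all (\<lambda>((b, e'), x, z). period_color (t div 2) = b \<or> even t \<and> \<not> e' \<or> x \<le> z - 2)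
    (zip slots (zip (rotate1 (slot_table ! ?t)) (slot_table ! (Suc t mod 32))))"
    using list_all_zipD[OF slot_table_edge_code, of ?t]
    by (simp add: slot_table_lengths slots_nth rotate1_slot_table_nth)
  from list_all_zipD[OF this, of ?v] show ?thesis
    using assms
    by (auto simp: slot_table_lengths slots_nth rotate1_slot_table_row_nth slot_bound_def[of "Suc t"])
qed

text \<open>Here both end vertices are completely inside. The even slot \<open>y\<close> is the
  boundary between two vertices at which the inside of the edge splits.\<close>

lemma slot_bound_close:
  assumes "period_color (t div 2) \<noteq> period_color (v div 2)" "even t" "odd v" "even y"
  shows "slot_bound t (Suc v) \<le> slot_bound (Suc t) y + slot_bound y v - 2"
proof -
  define i where "i = t div 2 mod 16"
  define k where "k = v div 2 mod 16"
  define l where "l = y div 2 mod 16"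
  have parity: "t mod 2 = 0" "Suc t mod 2 = 1" "Suc t div 2 = t div 2" "v mod 2 = 1" "y mod 2 = 0"
    using assms(2-4) by (simp_all add: odd_iff_mod_2_eq_one mod_Suc)
  have i: "i < 16" "t mod 32 = 2 * i" "Suc t mod 32 = 2 * i + 1"
    unfolding i_def slot_mod[of t] slot_mod[of "Suc t"] parity by simp_all
  have k: "k < 16" "v mod 32 = 2 * k + 1"
    unfolding k_def slot_mod[of v] parity by simp_all
  have l: "l < 16" "y mod 32 = 2 * l"
    unfolding l_def slot_mod[of y] parity by simp_all
  have colors: "color_period ! i = period_color (t div 2)" "color_period ! k = period_color (v div 2)"
    by (simp_all add: period_color_def i_def k_def)
  note lengths = slot_table_lengths evens_length odds_length length_color_period
  have "list_all (\<lambda>(q, r''). list_all (\<lambda>(b, x, z). period_color (t div 2) = b \<or> x \<le> q + z - 2)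
      (zip color_period (zip (odds (rotate1 (slot_table ! (2 * i)))) r'')))
     (zip (evens (slot_table ! (2 * i + 1))) (map odds (evens slot_table)))"
    using list_all_zipD[OF slot_table_close_code, of i] i
    by (simp add: lengths evens_nth odds_nth colors)
  from list_all_zipD[OF this, of l]
  have "list_all (\<lambda>(b, x, z). period_color (t div 2) = b \<or> x \<le> slot_bound (Suc t) y + z - 2)
      (zip color_period (zip (odds (rotate1 (slot_table ! (2 * i)))) (odds (slot_table ! (2 * l)))))"
    using i l by (simp add: lengths evens_nth odds_nth slot_bound_def)
  from list_all_zipD[OF this, of k]
  have "rotate1 (slot_table ! (2 * i)) ! (2 * k + 1) \<le> slot_bound (Suc t) y + slot_table ! (2 * l) ! (2 * k + 1) - 2"
    using assms(1) i k l by (simp add: lengths odds_nth colors)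
  then show ?thesis
    using rotate1_slot_table_row_nth[of t v] i k l by (simp add: slot_bound_def[of y])
qed

section \<open>Noncrossing forests\<close>

text \<open>Chords of points in convex position cross exactly when their end indices interleave.
  Acyclicity is encoded by demanding that every edge be a bridge of the underlying undirected
  graph.\<close>

definition noncrossing_forest :: "(nat \<times> nat) set \<Rightarrow> bool" where
  "noncrossing_forest E \<longleftrightarrow> finite E \<and> (\<forall>(a, b)\<in>E. a < b) \<and>
     (\<forall>(a, b)\<in>E. \<forall>(c, d)\<in>E. \<not> (a < c \<and> c < b \<and> b < d)) \<and>
     (\<forall>e\<in>E. e \<notin> ((E - {e}) \<union> (E - {e})\<inverse>)\<^sup>*)"

definition alternating :: "(nat \<times> nat) set \<Rightarrow> bool" where
  "alternating E \<longleftrightarrow> (\<forall>(a, b)\<in>E. period_color a \<noteq> period_color b)"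

definition left_degree :: "(nat \<times> nat) set \<Rightarrow> nat \<Rightarrow> nat" where
  "left_degree E v = card {e \<in> E. snd e = v}"

definition right_degree :: "(nat \<times> nat) set \<Rightarrow> nat \<Rightarrow> nat" where
  "right_degree E v = card {e \<in> E. fst e = v}"

text \<open>
  Vertex \<open>v\<close> owns the slots \<open>2 * v\<close> and \<open>2 * v + 1\<close>, one for each edge it may have. An interval
  of slots may thus start or end in the middle of a vertex.
\<close>
definition slots_at :: "nat \<Rightarrow> nat \<Rightarrow> nat \<Rightarrow> nat" where
  "slots_at t u v = of_bool (t \<le> 2 * v \<and> 2 * v < u) + of_bool (t \<le> 2 * v + 1 \<and> 2 * v + 1 < u)"

text \<open>Edges are only counted against the slots of a vertex, never assigned to particular
  slots. Each reduction may therefore choose which slot an edge takes.\<close>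

definition fits :: "(nat \<times> nat) set \<Rightarrow> nat \<Rightarrow> nat \<Rightarrow> bool" where
  "fits E t u \<longleftrightarrow> (\<forall>v. left_degree E v + right_degree E v \<le> slots_at t u v)"

section \<open>Subforests, degrees, and cutting an interval of slots\<close>

lemma noncrossing_forest_subset:
  assumes "noncrossing_forest E" "F \<subseteq> E"
  shows "noncrossing_forest F"
proof -
  have "e \<notin> ((F - {e}) \<union> (F - {e})\<inverse>)\<^sup>*" if "e \<in> F" for e
  proof -
    have "((F - {e}) \<union> (F - {e})\<inverse>)\<^sup>* \<subseteq> ((E - {e}) \<union> (E - {e})\<inverse>)\<^sup>*"
      using assms(2) by (intro rtrancl_mono) auto
    then show ?thesis
      using assms that by (auto simp: noncrossing_forest_def)
  qed
  moreover have "finite F"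
    using assms finite_subset by (auto simp: noncrossing_forest_def)
  ultimately show ?thesis
    using assms unfolding noncrossing_forest_def by blast
qed

lemma alternating_subset: "alternating E \<Longrightarrow> F \<subseteq> E \<Longrightarrow> alternating F"
  by (auto simp: alternating_def)

lemma degree_mono:
  assumes "finite E" "F \<subseteq> E"
  shows "left_degree F v \<le> left_degree E v" "right_degree F v \<le> right_degree E v"
  using assms by (auto simp: left_degree_def right_degree_def intro!: card_mono)

lemma degree_eq_0_iff:
  assumes "finite E"
  shows "left_degree E v = 0 \<longleftrightarrow> (\<forall>a. (a, v) \<notin> E)" "right_degree E v = 0 \<longleftrightarrow> (\<forall>b. (v, b) \<notin> E)"
  using assms by (force simp: left_degree_def right_degree_def)+

lemma slots_at_le_2: "slots_at t u v \<le> 2"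
  by (simp add: slots_at_def)

lemma degree_remove:
  assumes "finite E" "(i, j) \<in> E"
  shows "left_degree (E - {(i, j)}) v = left_degree E v - of_bool (v = j)"
    "right_degree (E - {(i, j)}) v = right_degree E v - of_bool (v = i)"
proof -
  have "{e \<in> E - {(i, j)}. snd e = v} = (if v = j then {e \<in> E. snd e = v} - {(i, j)} else {e \<in> E. snd e = v})"
       "{e \<in> E - {(i, j)}. fst e = v} = (if v = i then {e \<in> E. fst e = v} - {(i, j)} else {e \<in> E. fst e = v})"
    by auto
  then show "left_degree (E - {(i, j)}) v = left_degree E v - of_bool (v = j)"
    "right_degree (E - {(i, j)}) v = right_degree E v - of_bool (v = i)"
    using assms by (auto simp: left_degree_def right_degree_def)
qed

lemma fits_edge_range:
  assumes "fits E t u" "finite E" "(a, b) \<in> E"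
  shows "t \<le> 2 * a + 1" "2 * a < u" "t \<le> 2 * b + 1" "2 * b < u"
proof -
  have "right_degree E a \<noteq> 0" "left_degree E b \<noteq> 0"
    using assms by (auto simp: degree_eq_0_iff)
  then have "slots_at t u a \<noteq> 0" "slots_at t u b \<noteq> 0"
    using assms(1) unfolding fits_def by (metis add_is_0 le_zero_eq)+
  then show "t \<le> 2 * a + 1" "2 * a < u" "t \<le> 2 * b + 1" "2 * b < u"
    by (auto simp: slots_at_def split: if_splits)
qed

text \<open>At the cut vertex \<open>j\<close> the edges going left take the first slots and those
  going right the remaining ones. The cut \<open>y\<close> separates them, so it may fall before,
  inside or after the two slots of \<open>j\<close>.\<close>

lemma fits_split:
  assumes E: "noncrossing_forest E" and fits: "fits E t u"
    and sep: "\<And>a b. (a, b) \<in> E \<Longrightarrow> b \<le> j \<or> j \<le> a"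
    and y: "y = 2 * j + left_degree E j" "t \<le> 2 * j" "y \<le> u"
  shows "fits {e \<in> E. snd e \<le> j} t y" (is "fits ?E1 _ _")
    and "fits {e \<in> E. j \<le> fst e} y u" (is "fits ?E2 _ _")
    and "card E = card {e \<in> E. snd e \<le> j} + card {e \<in> E. j \<le> fst e}"
proof -
  have less: "a < b" if "(a, b) \<in> E" for a b
    using E that by (auto simp: noncrossing_forest_def)
  have fin: "finite E" "finite ?E1" "finite ?E2"
    using E by (auto simp: noncrossing_forest_def)
  have deg: "left_degree E v + right_degree E v \<le> slots_at t u v" for v
    using fits by (simp add: fits_def)
  have mono: "left_degree ?E1 v \<le> left_degree E v" "right_degree ?E1 v \<le> right_degree E v"
    "left_degree ?E2 v \<le> left_degree E v" "right_degree ?E2 v \<le> right_degree E v" for v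
    using fin(1) by (auto intro!: degree_mono)
  have zero1: "v > j \<Longrightarrow> left_degree ?E1 v = 0" "v \<ge> j \<Longrightarrow> right_degree ?E1 v = 0" for v
    using fin less by (fastforce simp: degree_eq_0_iff)+
  have zero2: "v \<le> j \<Longrightarrow> left_degree ?E2 v = 0" "v < j \<Longrightarrow> right_degree ?E2 v = 0" for v
    using fin less by (fastforce simp: degree_eq_0_iff)+
  have "left_degree E j \<le> 2"
    using deg[of j] slots_at_le_2[of t u j] by linarith
  show "fits ?E1 t y"
    unfolding fits_def
  proof
    fix v
    consider "v < j" | "v = j" | "v > j" by linarith
    then show "left_degree ?E1 v + right_degree ?E1 v \<le> slots_at t y v"
    proof cases
      case 1
      then have "slots_at t y v = slots_at t u v"
        using y by (auto simp: slots_at_def)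
      then show ?thesis
        using deg[of v] mono[of v] by linarith
    next
      case 2
      have "left_degree E j \<le> slots_at t y j"
        using y(2) \<open>left_degree E j \<le> 2\<close> unfolding y(1) slots_at_def by auto
      then show ?thesis
        using 2 zero1(2)[of j] mono(1)[of j] by simp
    next
      case 3
      then show ?thesis
        by (simp add: zero1)
    qed
  qed
  show "fits ?E2 y u"
    unfolding fits_def
  proof
    fix v
    consider "v < j" | "v = j" | "v > j" by linarith
    then show "left_degree ?E2 v + right_degree ?E2 v \<le> slots_at y u v"
    proof cases
      case 1
      then show ?thesis
        by (simp add: zero2)
    next
      case 2
      \<comment> \<open>Cutting at \<open>y\<close> removes at most \<open>left_degree E j\<close>
        slots of \<open>j\<close>, which leaves room for its edges to the right.\<close>
      have "slots_at t u j \<le> slots_at y u j + left_degree E j"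
        using y(2) \<open>left_degree E j \<le> 2\<close> unfolding y(1) slots_at_def by auto
      then show ?thesis
        using 2 zero2(1)[of j] mono(4)[of j] deg[of j] by simp
    next
      case 3
      then have "slots_at y u v = slots_at t u v"
        using y \<open>left_degree E j \<le> 2\<close> by (auto simp: slots_at_def)
      then show ?thesis
        using deg[of v] mono[of v] by linarith
    qed
  qed
  have "E = ?E1 \<union> ?E2"
    by (force dest: sep)
  then have "card E = card (?E1 \<union> ?E2)"
    by (rule arg_cong)
  also have "\<dots> = card ?E1 + card ?E2"
    using less by (intro card_Un_disjoint fin) fastforce
  finally show "card E = card ?E1 + card ?E2" .
qed

text \<open>
  The gap lies just after the largest vertex of the component of \<open>i\<close> without the edge
  \<open>(i, j)\<close>.
\<close>
lemma component_gap:
  assumes E: "noncrossing_forest E" and ij: "(i, j) \<in> E"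
    and range: "\<And>a b. (a, b) \<in> E \<Longrightarrow> i \<le> a \<and> b \<le> j"
  obtains m where "i < m" "m \<le> j" "\<And>a b. (a, b) \<in> E - {(i, j)} \<Longrightarrow> b < m \<or> m \<le> a"
proof -
  define F where "F = E - {(i, j)}"
  define K where "K = {k. (i, k) \<in> (F \<union> F\<inverse>)\<^sup>*}"
  have less: "a < b" if "(a, b) \<in> E" for a b
    using E that by (auto simp: noncrossing_forest_def)
  have nocross: False if "(a, b) \<in> E" "(c, d) \<in> E" "a < c" "c < b" "b < d" for a b c d
    using E that unfolding noncrossing_forest_def by fastforce
  have bound: "k \<le> j" if "k \<in> K" for k
  proof -
    have "(i, k) \<in> (F \<union> F\<inverse>)\<^sup>*"
      using that by (simp add: K_def)
    then show ?thesis
    proof cases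
      case base
      then show ?thesis
        using less[OF ij] by simp
    next
      case (step y)
      then show ?thesis
        using range less by (auto simp: F_def) (meson less_le_trans order.strict_implies_order)+
    qed
  qed
  have iK: "i \<in> K"
    by (simp add: K_def)
  have fin: "finite K"
    using bound by (meson finite_nat_set_iff_bounded_le)
  define x where "x = Max K"
  have xK: "x \<in> K" and x_max: "\<And>k. k \<in> K \<Longrightarrow> k \<le> x"
    using fin iK by (auto simp: x_def intro: Max_in)
  \<comment> \<open>Otherwise \<open>(i, j)\<close> would not be a bridge.\<close>
  have "j \<notin> K"
    using E ij by (auto simp: K_def F_def noncrossing_forest_def)
  then have "x < j"
    using bound[OF xK] xK by (metis le_neq_implies_less)
  have closed: "k' \<in> K" if "k \<in> K" "(k, k') \<in> F \<union> F\<inverse>" for k k'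
    using that by (auto simp: K_def intro: rtrancl_into_rtrancl)
  have gap: "b < Suc x \<or> Suc x \<le> a" if ab: "(a, b) \<in> F" for a b
  proof (rule ccontr)
    assume "\<not> ?thesis"
    then have ax: "a \<le> x" "x < b"
      by auto
    have "b \<notin> K"
      using ax x_max by fastforce
    then have aK: "a \<notin> K"
      using closed ab by blast
    have "i \<le> a"
      using range ab unfolding F_def by blast
    then have "i < a"
      using aK iK by (metis le_neq_implies_less)
    \<comment> \<open>A walk from \<open>i\<close> stays left of \<open>a\<close>: it avoids
      \<open>a\<close> itself and never exceeds \<open>x\<close>, which lies left of
      \<open>b\<close>. A step over \<open>a\<close> would thus land strictly between
      \<open>a\<close> and \<open>b\<close> and cross \<open>(a, b)\<close>. But \<open>x\<close> is
      reachable and not left of \<open>a\<close>.\<close>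
    have below: "k < a" if "(i, k) \<in> (F \<union> F\<inverse>)\<^sup>*" for k
      using that
    proof (induction rule: rtrancl_induct)
      case base
      then show ?case by fact
    next
      case (step k k')
      have "k' \<in> K"
        using step.hyps closed by (auto simp: K_def)
      then have k': "k' \<noteq> a" "k' < b"
        using aK x_max[of k'] ax by auto
      show ?case
      proof (rule ccontr)
        assume "\<not> k' < a"
        then have "a < k'"
          using k' by auto
        moreover have "(k, k') \<in> E"
          using step.hyps(2) less[of k' k] \<open>a < k'\<close> step.IH by (auto simp: F_def)
        ultimately show False
          using nocross[of k k' a b] step.IH k' ab by (simp add: F_def)
      qed
    qed
    have "x < a"
      using below xK by (simp add: K_def)
    then show False
      using ax by simp
  qed
  show ?thesis
    using that[of "Suc x"] gap \<open>x < j\<close> x_max[OF iK] by (simp add: F_def)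
qed

lemma slot_bound_le:
  assumes "noncrossing_forest E" "alternating E" "fits E t u" "t \<le> u"
  shows "slot_bound t u \<le> 23 * (int u - int t) - 48 * int (card E)"
  using assms
proof (induction "u - t" arbitrary: t u E rule: less_induct)
  case less
  note E = less.prems(1) and alt = less.prems(2) and fits = less.prems(3)
  have edge_less: "a < b" if "(a, b) \<in> E" for a b
    using E that by (auto simp: noncrossing_forest_def)
  have nocross: False if "(a, b) \<in> E" "(c, d) \<in> E" "a < c" "c < b" "b < d" for a b c d
    using E that unfolding noncrossing_forest_def by fastforce
  have fin: "finite E"
    using E by (simp add: noncrossing_forest_def)
  have deg: "left_degree E v + right_degree E v \<le> slots_at t u v" for v
    using fits by (simp add: fits_def)
  note range = fits_edge_range[OF fits fin]
  \<comment> \<open>Stated for a subset \<open>F\<close> and its own interval, since it serves both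
    for \<open>E\<close> on \<open>[t, u)\<close> and for the inside of an edge.\<close>
  have split: "slot_bound t' y + slot_bound y u' \<le> 23 * (int u' - int t') - 48 * int (card F)"
    if F: "F \<subseteq> E" "fits F t' u'" "\<And>a b. (a, b) \<in> F \<Longrightarrow> b \<le> j \<or> j \<le> a"
      and y: "y = 2 * j + left_degree F j" "t' \<le> 2 * j" "y \<le> u'"
      and shorter: "y - t' < u - t" "u' - y < u - t"
    for F t' u' j y
  proof -
    let ?F1 = "{e \<in> F. snd e \<le> j}" and ?F2 = "{e \<in> F. j \<le> fst e}"
    have nF: "noncrossing_forest F"
      using E F(1) by (rule noncrossing_forest_subset)
    note parts = fits_split[OF nF F(2,3) y]
    have sub: "?F1 \<subseteq> E" "?F2 \<subseteq> E"
      using F(1) by auto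
    have "slot_bound t' y \<le> 23 * (int y - int t') - 48 * int (card ?F1)"
      using y by (intro less.hyps[OF shorter(1)] noncrossing_forest_subset[OF E] alternating_subset[OF alt] sub parts) auto
    moreover have "slot_bound y u' \<le> 23 * (int u' - int y) - 48 * int (card ?F2)"
      using y by (intro less.hyps[OF shorter(2)] noncrossing_forest_subset[OF E] alternating_subset[OF alt] sub parts) auto
    ultimately show ?thesis
      using parts(3) by simp
  qed
  define i where "i = t div 2"
  have t: "2 * i \<le> t" "t \<le> 2 * i + 1"
    by (auto simp: i_def)
  consider "t = u" | "t < u" "left_degree E i + right_degree E i < slots_at t u i"
    | "t < u" "left_degree E i + right_degree E i = slots_at t u i"
    using deg[of i] less.prems(4) by linarith
  then show ?case
  proof cases
    case 1
    have "E = {}"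
    proof (rule ccontr)
      assume "E \<noteq> {}"
      then obtain a b where ab: "(a, b) \<in> E"
        by auto
      show False
        using range[OF ab] edge_less[OF ab] 1 by linarith
    qed
    then show ?thesis
      using 1 by (simp add: slot_bound_refl)
  next
    case 2
    \<comment> \<open>Vertex \<open>i\<close> has a spare slot, which can be taken to be the first
      one.\<close>
    have "fits E (Suc t) u"
      unfolding fits_def
    proof
      fix v
      show "left_degree E v + right_degree E v \<le> slots_at (Suc t) u v"
      proof (cases "v = i")
        case True
        have "slots_at t u i = Suc (slots_at (Suc t) u i)"
          using t 2(1) by (auto simp: slots_at_def)
        then show ?thesis
          using 2 True by simp
      next
        case False
        then have "slots_at (Suc t) u v = slots_at t u v"
          using t by (auto simp: slots_at_def)
        then show ?thesis
          using deg[of v] by simp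
      qed
    qed
    then have "slot_bound (Suc t) u \<le> 23 * (int u - int (Suc t)) - 48 * int (card E)"
      using 2 by (intro less.hyps E alt) auto
    then show ?thesis
      using slot_bound_triangle[of t u "Suc t"] slot_bound_step[of t] by simp
  next
    case 3
    have i_le: "i \<le> a" if "(a, b) \<in> E" for a b
      using range(1)[OF that] t by linarith
    define J where "J = {b. (i, b) \<in> E}"
    have "left_degree E i = 0"
      using fin i_le edge_less by (fastforce simp: degree_eq_0_iff)
    moreover have "slots_at t u i > 0"
      using t 3(1) by (auto simp: slots_at_def)
    ultimately have "right_degree E i \<noteq> 0"
      using 3(2) by simp
    then have "J \<noteq> {}"
      using fin by (auto simp: degree_eq_0_iff J_def)
    moreover have "finite J"
      using fin by (intro finite_subset[of J "snd ` E"]) (force simp: J_def)+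
    ultimately have j: "(i, Max J) \<in> E" "\<And>b. (i, b) \<in> E \<Longrightarrow> b \<le> Max J"
      using Max_in[of J] by (auto simp: J_def)
    define j where "j = Max J"
    define y where "y = 2 * j + left_degree E j"
    have ij: "(i, j) \<in> E" and jmax: "\<And>b. (i, b) \<in> E \<Longrightarrow> b \<le> j"
      using j by (auto simp: j_def)
    have "i < j"
      using ij by (rule edge_less)
    have Lj: "left_degree E j \<noteq> 0"
      using fin ij by (auto simp: degree_eq_0_iff)
    \<comment> \<open>No edge passes over the farthest neighbour \<open>j\<close>: it would cross
      \<open>(i, j)\<close>, or start at \<open>i\<close> and contradict the choice of
      \<open>j\<close>.\<close>
    have sep: "b \<le> j \<or> j \<le> a" if "(a, b) \<in> E" for a b
      using nocross[OF ij that] jmax i_le[OF that] that by (metis le_neq_implies_less not_le)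
    have "y \<le> u"
      using deg[of j] Lj by (auto simp: y_def slots_at_def of_bool_def split: if_splits)
    show ?thesis
    \<comment> \<open>If the interval continues after the left edges of \<open>j\<close>, it is cut
      there. Otherwise \<open>(i, j)\<close> joins its first and its last slot.\<close>
    proof (cases "y < u")
      case True
      have "slot_bound t y + slot_bound y u \<le> 23 * (int u - int t) - 48 * int (card E)"
        using True \<open>i < j\<close> t Lj 3(1) by (intro split[OF subset_refl fits sep y_def]) (auto simp: y_def)
      then show ?thesis
        using slot_bound_triangle[of t u y] by linarith
    next
      case False
      then have u: "u = 2 * j + left_degree E j"
        using \<open>y \<le> u\<close> by (simp add: y_def)
      define v where "v = u - 1"
      have uv: "u = Suc v"
        using u Lj by (simp add: v_def)
      have "left_degree E j \<le> 2"
        using deg[of j] slots_at_le_2[of t u j] by linarith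
      then have v: "2 * j \<le> v" "v \<le> 2 * j + 1"
        using u uv Lj by linarith+
      define F where "F = E - {(i, j)}"
      have "F \<subseteq> E"
        by (auto simp: F_def)
      have card_F: "int (card E) = int (card F) + 1"
        using card.remove[OF fin ij] by (simp add: F_def)
      have fits_F: "fits F (Suc t) v"
        unfolding fits_def
      proof
        fix w
        have "left_degree F w = left_degree E w - of_bool (w = j)" "right_degree F w = right_degree E w - of_bool (w = i)"
          unfolding F_def using fin ij by (rule degree_remove)+
        moreover have "w = j \<Longrightarrow> left_degree E w \<noteq> 0" "w = i \<Longrightarrow> right_degree E w \<noteq> 0"
          using Lj \<open>right_degree E i \<noteq> 0\<close> by auto
        moreover have "slots_at t u w = slots_at (Suc t) v w + of_bool (w = i) + of_bool (w = j)"
          using t v \<open>i < j\<close> uv by (auto simp: slots_at_def)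
        ultimately show "left_degree F w + right_degree F w \<le> slots_at (Suc t) v w"
          using deg[of w] \<open>i < j\<close> by (cases "w = i"; cases "w = j") auto
      qed
      have len: "Suc t \<le> v" "v - Suc t < u - t"
        using t v \<open>i < j\<close> uv by linarith+
      have div: "t div 2 = i" "v div 2 = j"
        using v by (auto simp: i_def)
      have "period_color i \<noteq> period_color j"
        using alt ij by (auto simp: alternating_def)
      then have colors: "period_color (t div 2) \<noteq> period_color (v div 2)"
        by (simp add: div)
      show ?thesis
      proof (cases "odd t \<or> even v")
        case True
        have "slot_bound (Suc t) v \<le> 23 * (int v - int (Suc t)) - 48 * int (card F)"
          by (intro less.hyps len fits_F noncrossing_forest_subset[OF E] alternating_subset[OF alt]) fact+
        then show ?thesis
          using slot_bound_edge[OF colors True] card_F uv by simp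
      next
        \<comment> \<open>All four slots of \<open>i\<close> and \<open>j\<close> lie in the
          interval, so the split comes from the gap that the bridge \<open>(i, j)\<close>
          leaves.\<close>
        case even: False
        have "b \<le> j" if "(a, b) \<in> E" for a b
          using range(4)[OF that] v uv by linarith
        then obtain m where m: "i < m" "m \<le> j" "\<And>a b. (a, b) \<in> F \<Longrightarrow> b < m \<or> m \<le> a"
          using component_gap[OF E ij] i_le unfolding F_def by metis
        \<comment> \<open>No edge of \<open>F\<close> reaches \<open>m\<close> from the left, so the
          cut of \<open>F\<close> at \<open>m\<close> is exactly the vertex boundary
          \<open>2 * m\<close>.\<close>
        have "left_degree F m = 0"
          using fin m(3) edge_less by (fastforce simp: degree_eq_0_iff F_def)
        then have "slot_bound (Suc t) (2 * m) + slot_bound (2 * m) v \<le> 23 * (int v - int (Suc t)) - 48 * int (card F)"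
          using m t v uv \<open>F \<subseteq> E\<close> fits_F by (intro split[where j = m]) (auto dest: m(3))
        then show ?thesis
          using slot_bound_close[OF colors, of "2 * m"] even card_F uv by simp
      qed
    qed
  qed
qed

text \<open>The interval \<open>[0, 2 * n)\<close> contains all slots, and its bound lies in the
  nonnegative first row of the table.\<close>

lemma noncrossing_forest_card:
  assumes "noncrossing_forest E" "alternating E" "\<And>a b. (a, b) \<in> E \<Longrightarrow> b < n"
    and "\<And>v. left_degree E v + right_degree E v \<le> 2"
  shows "24 * card E \<le> 23 * n"
proof -
  have fin: "finite E" and less: "\<And>a b. (a, b) \<in> E \<Longrightarrow> a < b"
    using assms(1) by (auto simp: noncrossing_forest_def)
  have "fits E 0 (2 * n)"
    unfolding fits_def
  proof
    fix v
    show "left_degree E v + right_degree E v \<le> slots_at 0 (2 * n) v"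
    proof (cases "v < n")
      case True
      then show ?thesis
        using assms(4)[of v] by (simp add: slots_at_def)
    next
      case False
      then have "left_degree E v = 0" "right_degree E v = 0"
        using fin less assms(3) by (fastforce simp: degree_eq_0_iff)+
      then show ?thesis
        by simp
    qed
  qed
  from slot_bound_le[OF assms(1,2) this] slot_bound_start[of "2 * n"] show ?thesis
    by simp
qed

section \<open>Paths through a convex chain\<close>

text \<open>This isolates the combinatorics of the path from the geometry: \<open>C\<close> stands
  for the convex chain and \<open>idx\<close> for the left-to-right position in it.\<close>

locale indexed_path =
  fixes ps :: "'a list" and C :: "'a set" and idx :: "'a \<Rightarrow> nat"
  assumes distinct_path: "distinct ps" and inj_idx: "inj_on idx C" and sub_path: "C \<subseteq> set ps"
begin

definition inner_steps :: "nat set" where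
  "inner_steps = {k. Suc k < length ps \<and> ps ! k \<in> C \<and> ps ! Suc k \<in> C}"

definition chord :: "nat \<Rightarrow> nat \<times> nat" where
  "chord k = (min (idx (ps ! k)) (idx (ps ! Suc k)), max (idx (ps ! k)) (idx (ps ! Suc k)))"

definition chords :: "(nat \<times> nat) set" where
  "chords = chord ` inner_steps"

lemma finite_inner_steps: "finite inner_steps"
  by (rule finite_subset[of _ "{..<length ps}"]) (auto simp: inner_steps_def)

lemma idx_eq_iff:
  assumes "k < length ps" "l < length ps" "ps ! k \<in> C" "ps ! l \<in> C"
  shows "idx (ps ! k) = idx (ps ! l) \<longleftrightarrow> k = l"
  using assms distinct_path inj_idx by (metis inj_on_eq_iff nth_eq_iff_index_eq)

lemma chord_cases:
  assumes "k \<in> inner_steps"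
  obtains "chord k = (idx (ps ! k), idx (ps ! Suc k))" "idx (ps ! k) < idx (ps ! Suc k)"
  | "chord k = (idx (ps ! Suc k), idx (ps ! k))" "idx (ps ! Suc k) < idx (ps ! k)"
proof -
  have "idx (ps ! k) \<noteq> idx (ps ! Suc k)"
    using assms idx_eq_iff[of k "Suc k"] by (simp add: inner_steps_def)
  then consider "idx (ps ! k) < idx (ps ! Suc k)" | "idx (ps ! Suc k) < idx (ps ! k)"
    by linarith
  then show ?thesis
    by cases (use that in \<open>auto simp: chord_def\<close>)
qed

lemma chords_less: "(a, b) \<in> chords \<Longrightarrow> a < b"
  by (auto simp: chords_def elim: chord_cases)

lemma chord_endpoint:
  assumes "k \<in> inner_steps" "l < length ps" "ps ! l \<in> C"
    and "fst (chord k) = idx (ps ! l) \<or> snd (chord k) = idx (ps ! l)"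
  shows "l = k \<or> l = Suc k"
  by (rule chord_cases[OF assms(1)];
      use assms idx_eq_iff[of k l] idx_eq_iff[of "Suc k" l] in \<open>auto simp: inner_steps_def\<close>)

lemma inj_on_chord: "inj_on chord inner_steps"
proof (rule inj_onI)
  fix k k'
  assume k: "k \<in> inner_steps" "k' \<in> inner_steps" "chord k = chord k'"
  have "l = k' \<or> l = Suc k'" if "l = k \<or> l = Suc k" for l
    by (rule chord_cases[OF k(1)];
        use chord_endpoint[OF k(2), of l] k that in \<open>auto simp: inner_steps_def\<close>)
  from this[of k] this[of "Suc k"] show "k = k'"
    by auto
qed

text \<open>Each path vertex outside \<open>C\<close> spoils at most two steps, the one entering and
  the one leaving it. The path has \<open>card C + card (set ps - C) - 1\<close> steps.\<close>

lemma card_chords: "card C \<le> card chords + 1 + card (set ps - C)"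
proof -
  let ?out = "{k. k < length ps \<and> ps ! k \<notin> C}"
  have "bij_betw ((!) ps) ?out (set ps - C)"
    using distinct_path by (auto simp: bij_betw_def inj_on_def nth_eq_iff_index_eq in_set_conv_nth)
  then have out: "card ?out = card (set ps - C)"
    by (rule bij_betw_same_card)
  \<comment> \<open>A spoiled step \<open>k\<close> has position \<open>k\<close> or
    \<open>Suc k\<close> outside \<open>C\<close>. At position 0 the truncated \<open>k - 1\<close>
    gives 0, harmless for a covering.\<close>
  have "{..<length ps - 1} \<subseteq> inner_steps \<union> ?out \<union> (\<lambda>k. k - 1) ` ?out"
  proof
    fix k
    assume "k \<in> {..<length ps - 1}"
    then have "Suc k < length ps"
      by auto
    then show "k \<in> inner_steps \<union> ?out \<union> (\<lambda>k. k - 1) ` ?out"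
      by (cases "ps ! Suc k \<in> C") (auto simp: inner_steps_def intro!: rev_image_eqI[of "Suc k"])
  qed
  then have "card {..<length ps - 1} \<le> card (inner_steps \<union> ?out \<union> (\<lambda>k. k - 1) ` ?out)"
    using finite_inner_steps by (intro card_mono) auto
  also have "\<dots> \<le> card inner_steps + card ?out + card ((\<lambda>k. k - 1) ` ?out)"
    by (meson add_le_mono1 card_Un_le le_trans)
  also have "card ((\<lambda>k. k - 1) ` ?out) \<le> card ?out"
    by (rule card_image_le) auto
  finally have "length ps - 1 \<le> card chords + 2 * card (set ps - C)"
    by (simp add: out chords_def card_image[OF inj_on_chord])
  moreover have "card (set ps - C) + card C = length ps"
    using card_Diff_subset[of C "set ps"] card_mono[of "set ps" C] finite_subset[OF sub_path] sub_path
    by (simp add: distinct_card[OF distinct_path])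
  ultimately show ?thesis
    by linarith
qed

text \<open>Only the steps before and after position \<open>r\<close> can yield a chord at the index
  of \<open>ps ! r\<close>.\<close>

lemma degree_chords: "left_degree chords v + right_degree chords v \<le> 2"
proof (cases "\<exists>r < length ps. ps ! r \<in> C \<and> idx (ps ! r) = v")
  case True
  then obtain r where r: "r < length ps" "ps ! r \<in> C" "idx (ps ! r) = v"
    by blast
  let ?L = "{e \<in> chords. snd e = v}" and ?R = "{e \<in> chords. fst e = v}"
  have fin: "finite chords"
    using finite_inner_steps by (simp add: chords_def)
  have "?L \<union> ?R \<subseteq> chord ` {r, r - 1}"
  proof
    fix e
    assume "e \<in> ?L \<union> ?R"
    then obtain k where "k \<in> inner_steps" "e = chord k" "fst (chord k) = v \<or> snd (chord k) = v"
      by (auto simp: chords_def)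
    then show "e \<in> chord ` {r, r - 1}"
      using chord_endpoint[of k r] r by auto
  qed
  then have "card (?L \<union> ?R) \<le> card (chord ` {r, r - 1})"
    by (intro card_mono) auto
  also have "\<dots> \<le> card {r, r - 1}"
    by (rule card_image_le) auto
  also have "\<dots> \<le> 2"
    by (simp add: card_insert_if)
  also have "card (?L \<union> ?R) = card ?L + card ?R"
    using fin chords_less by (intro card_Un_disjoint) fastforce+
  finally show ?thesis
    by (simp add: left_degree_def right_degree_def)
next
  case False
  have "fst e \<noteq> v \<and> snd e \<noteq> v" if "e \<in> chords" for e
    using that False
    by (auto simp: chords_def inner_steps_def chord_def min_def max_def) (metis Suc_lessD)+
  then have empty: "{e \<in> chords. snd e = v} = {}" "{e \<in> chords. fst e = v} = {}"
    by blast+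
  show ?thesis
    unfolding left_degree_def right_degree_def empty by simp
qed

text \<open>Removing a step separates the vertices before it from those after it.\<close>
lemma chord_bridge:
  assumes "e \<in> chords"
  shows "e \<notin> ((chords - {e}) \<union> (chords - {e})\<inverse>)\<^sup>*"
proof
  assume path: "e \<in> ((chords - {e}) \<union> (chords - {e})\<inverse>)\<^sup>*"
  obtain k where k: "k \<in> inner_steps" "e = chord k"
    using assms by (auto simp: chords_def)
  \<comment> \<open>The side of the cut that contains the start of the path: the indices visited up
    to position \<open>k\<close>.\<close>
  define S where "S = {idx (ps ! l) |l. l \<le> k \<and> ps ! l \<in> C}"
  have S_iff: "idx (ps ! l) \<in> S \<longleftrightarrow> l \<le> k" if "l < length ps" "ps ! l \<in> C" for l
  proof
    assume "idx (ps ! l) \<in> S"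
    then obtain l' where "l' \<le> k" "ps ! l' \<in> C" "idx (ps ! l) = idx (ps ! l')"
      by (auto simp: S_def)
    moreover have "l' < length ps"
      using \<open>l' \<le> k\<close> k(1) by (simp add: inner_steps_def)
    ultimately show "l \<le> k"
      using idx_eq_iff[of l l'] that by simp
  qed (use that in \<open>auto simp: S_def\<close>)
  \<comment> \<open>Step \<open>k\<close> is the only one that changes sides, so a walk along the
    other chords never leaves its side.\<close>
  have chord_S: "(x \<in> S \<longleftrightarrow> y \<in> S) \<longleftrightarrow> k' \<noteq> k" if "k' \<in> inner_steps" "chord k' = (x, y)" for k' x y
    by (rule chord_cases[OF that(1)];
        use that S_iff[of k'] S_iff[of "Suc k'"] in \<open>auto simp: inner_steps_def\<close>)
  have "x \<in> S \<longleftrightarrow> y \<in> S" if "(x, y) \<in> ((chords - {e}) \<union> (chords - {e})\<inverse>)\<^sup>*" for x y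
    using that
  proof (induction rule: rtrancl_induct)
    case (step y z)
    have other: "\<exists>k'\<in>inner_steps. chord k' = p \<and> k' \<noteq> k" if "p \<in> chords - {e}" for p
      using that k(2) unfolding chords_def by blast
    have "y \<in> S \<longleftrightarrow> z \<in> S"
      using step.hyps(2) other[of "(y, z)"] other[of "(z, y)"] chord_S by blast
    then show ?case
      using step.IH by simp
  qed simp
  then show False
    using chord_S[of k] k path by (metis surj_pair)
qed

lemma noncrossing_forest_chords:
  assumes "\<And>a b c d. (a, b) \<in> chords \<Longrightarrow> (c, d) \<in> chords \<Longrightarrow> a < c \<Longrightarrow> c < b \<Longrightarrow> b < d \<Longrightarrow> False"
  shows "noncrossing_forest chords"
proof -
  have "finite chords"
    using finite_inner_steps by (simp add: chords_def)
  then show ?thesis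
    using assms chords_less chord_bridge unfolding noncrossing_forest_def by blast
qed

end

section \<open>Crossing chords of a strictly convex graph\<close>

lemma in_open_segment_graph:
  fixes a b x ya yb :: real
  assumes "a < x" "x < b"
  shows "(x, ya + (x - a) * ((yb - ya) / (b - a))) \<in> open_segment (a, ya) (b, yb)"
proof -
  define u where "u = (x - a) / (b - a)"
  have u: "0 < u" "u < 1"
    using assms by (auto simp: u_def field_simps)
  have "u * (b - a) = x - a"
    using assms by (simp add: u_def)
  then have "x = (1 - u) * a + u * b"
    by (simp add: algebra_simps)
  moreover have "ya + (x - a) * ((yb - ya) / (b - a)) = (1 - u) * ya + u * yb"
    by (simp add: u_def algebra_simps diff_divide_distrib)
  ultimately have "(x, ya + (x - a) * ((yb - ya) / (b - a))) = (1 - u) *\<^sub>R (a, ya) + u *\<^sub>R (b, yb)"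
    by simp
  then show ?thesis
    using u assms by (auto simp: in_segment)
qed

lemma strictly_convex_below_chord:
  assumes "strictly_convex f" "a < x" "x < b"
  shows "f x < f a + (x - a) * ((f b - f a) / (b - a))"
proof -
  define u where "u = (x - a) / (b - a)"
  have u: "0 < u" "u < 1"
    using assms by (auto simp: u_def field_simps)
  have "u * (b - a) = x - a"
    using assms by (simp add: u_def)
  then have "x = (1 - u) * a + u * b"
    by (simp add: algebra_simps)
  moreover have "f a + (x - a) * ((f b - f a) / (b - a)) = (1 - u) * f a + u * f b"
    by (simp add: u_def algebra_simps diff_divide_distrib)
  moreover have "f ((1 - u) * a + u * b) < (1 - u) * f a + u * f b"
    using assms u unfolding strictly_convex_def by (metis less_irrefl less_trans)
  ultimately show ?thesis
    by simp
qed

text \<open>By convexity the line through \<open>a\<close> and \<open>b\<close> is above the other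
  line at \<open>c\<close> and below it at \<open>b\<close>, so the two meet in between.\<close>

lemma strictly_convex_segments_meet:
  fixes a b c d :: real
  assumes f: "strictly_convex f" and less: "a < c" "c < b" "b < d"
  shows "open_segment (a, f a) (b, f b) \<inter> open_segment (c, f c) (d, f d) \<noteq> {}"
proof -
  define m1 where "m1 = (f b - f a) / (b - a)"
  define m2 where "m2 = (f d - f c) / (d - c)"
  define p where "p = f a + (c - a) * m1 - f c"
  define q where "q = f c + (b - c) * m2 - f b"
  have "p > 0" "q > 0"
    using strictly_convex_below_chord[OF f, of a c b] strictly_convex_below_chord[OF f, of c b d] less
    by (auto simp: p_def q_def m1_def m2_def)
  \<comment> \<open>The height difference of the two lines is affine, with value \<open>p\<close> at
    \<open>c\<close> and \<open>- q\<close> at \<open>b\<close>; it vanishes at the fraction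
    \<open>p / (p + q)\<close> of the way.\<close>
  define u where "u = p / (p + q)"
  define x where "x = c + u * (b - c)"
  have "0 < u" "u < 1"
    using \<open>p > 0\<close> \<open>q > 0\<close> by (auto simp: u_def)
  then have "0 < u * (b - c)" "u * (b - c) < 1 * (b - c)"
    using less by (auto intro!: mult_strict_right_mono)
  then have x: "c < x" "x < b"
    by (auto simp: x_def)
  have "m1 * (b - a) = f b - f a"
    using less by (simp add: m1_def)
  then have "p + q = (b - c) * (m2 - m1)"
    by (simp add: p_def q_def algebra_simps)
  moreover have "u * (p + q) = p"
    using \<open>p > 0\<close> \<open>q > 0\<close> by (simp add: u_def)
  moreover have "(x - c) * (m2 - m1) = u * ((b - c) * (m2 - m1))"
    by (simp add: x_def)
  ultimately have "p = (x - c) * (m2 - m1)"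
    by simp
  then have "f a + (x - a) * m1 = f c + (x - c) * m2"
    by (simp add: p_def algebra_simps)
  then show ?thesis
    using in_open_segment_graph[of a x b "f a" "f b"] in_open_segment_graph[of c x d "f c" "f d"] x less
    by (auto simp: m1_def m2_def)
qed

text \<open>The locale \<open>folding_insort_key\<close> asks for a key that is injective on its
  carrier; taking \<open>C\<close> itself as the carrier makes its facts available.\<close>

lemma (in linorder) sorted_key_list_of_set_inj_on:
  assumes "finite C" "inj_on f C"
  shows "set (sorted_key_list_of_set f C) = C" "length (sorted_key_list_of_set f C) = card C"
    "sorted_wrt (<) (map f (sorted_key_list_of_set f C))"
proof -
  interpret folding_insort_key "(\<le>)" "(<)" C f
    by unfold_locales fact
  show "set (sorted_key_list_of_set f C) = C" "length (sorted_key_list_of_set f C) = card C"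
    "sorted_wrt (<) (map f (sorted_key_list_of_set f C))"
    using assms(1) by simp_all
qed

section \<open>From the double-chain to the forest of chords\<close>

theorem theorem2:
  fixes C1 C2 :: "point set" and col :: "point \<Rightarrow> color"
  assumes "double_chain C1 C2"
    and "periodic_with color_period (map col (left_to_right C1))"
    and "card C1 \<ge> 28 * (card C2 + 1)"
  shows "\<not> (\<exists>ps. noncrossing_hamiltonian_alternating_path col (C1 \<union> C2) ps)"
proof
  assume "\<exists>ps. noncrossing_hamiltonian_alternating_path col (C1 \<union> C2) ps"
  then obtain ps where ps: "distinct ps" "set ps = C1 \<union> C2"
    and alt: "successively (\<lambda>p q. col p \<noteq> col q) ps" and nc: "noncrossing_path ps"
    unfolding noncrossing_hamiltonian_alternating_path_def by blast
  have "convex_chain C1" and fin: "finite C1" "finite C2"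
    using assms(1) by (simp_all add: double_chain_def convex_chain_def concave_chain_def)
  then obtain f where f: "strictly_convex f" and graph: "\<And>p. p \<in> C1 \<Longrightarrow> snd p = f (fst p)"
    unfolding convex_chain_def by blast
  have "inj_on fst C1"
    by (rule inj_onI) (simp add: graph prod_eq_iff)
  note sorted = sorted_key_list_of_set_inj_on[OF fin(1) this]
  define L where "L = left_to_right C1"
  have L: "set L = C1" "length L = card C1" "sorted_wrt (<) (map fst L)"
    using sorted by (simp_all add: L_def left_to_right_def)
  have L_less: "fst (L ! a) < fst (L ! b)" if "a < b" "b < card C1" for a b
    using L(2,3) that by (auto simp: sorted_wrt_iff_nth_less)
  \<comment> \<open>The position of \<open>p\<close> in \<open>L\<close>, so \<open>idx\<close>
    inverts indexing on \<open>C1\<close>.\<close>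
  define idx where "idx p = (SOME a. a < card C1 \<and> L ! a = p)" for p
  have idx: "idx p < card C1" "L ! idx p = p" if "p \<in> C1" for p
  proof -
    have "\<exists>a. a < card C1 \<and> L ! a = p"
      using that in_set_conv_nth[of p L] by (simp add: L(1,2))
    from someI_ex[OF this] show "idx p < card C1" "L ! idx p = p"
      by (simp_all add: idx_def)
  qed
  interpret indexed_path ps C1 idx
    using ps idx(2) by unfold_locales (auto intro: inj_on_inverseI[of _ "(!) L"])
  have color: "col p = period_color (idx p)" if "p \<in> C1" for p
    using assms(2) idx[OF that] L(2)
    by (auto simp: periodic_with_def period_color_def length_color_period L_def[symmetric])
  have chord_points: "\<exists>k. k \<in> inner_steps \<and> (a, b) = chord k \<and> a < b \<and> b < card C1 \<and>
      (path_edge ps k = (L ! a, L ! b) \<or> path_edge ps k = (L ! b, L ! a))" if ab: "(a, b) \<in> chords" for a b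
  proof -
    obtain k where k: "k \<in> inner_steps" "(a, b) = chord k"
      using ab unfolding chords_def by blast
    then have "ps ! k \<in> C1" "ps ! Suc k \<in> C1"
      by (auto simp: inner_steps_def)
    then have "a < b \<and> b < card C1 \<and>
        (path_edge ps k = (L ! a, L ! b) \<or> path_edge ps k = (L ! b, L ! a))"
      by (rule_tac chord_cases[OF k(1)]; use k idx in \<open>simp add: path_edge_def\<close>)
    then show ?thesis
      using k by blast
  qed
  have "noncrossing_forest chords"
  proof (rule noncrossing_forest_chords)
    fix a b c d
    assume ab: "(a, b) \<in> chords" and cd: "(c, d) \<in> chords" and less: "a < c" "c < b" "b < d"
    obtain k where k: "k \<in> inner_steps" "(a, b) = chord k"
        "path_edge ps k = (L ! a, L ! b) \<or> path_edge ps k = (L ! b, L ! a)"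
      using chord_points[OF ab] by blast
    obtain l where l: "l \<in> inner_steps" "(c, d) = chord l" "d < card C1"
        "path_edge ps l = (L ! c, L ! d) \<or> path_edge ps l = (L ! d, L ! c)"
      using chord_points[OF cd] by blast
    have point: "L ! v = (fst (L ! v), f (fst (L ! v)))" if "v < card C1" for v
      using graph[of "L ! v"] that L(1,2) by (metis nth_mem prod.collapse)
    have "open_segment (L ! a) (L ! b) \<inter> open_segment (L ! c) (L ! d) \<noteq> {}"
      using strictly_convex_segments_meet[OF f, of "fst (L ! a)" "fst (L ! c)" "fst (L ! b)" "fst (L ! d)"]
        L_less less l(3) point[of a] point[of b] point[of c] point[of d] by simp
    \<comment> \<open>Both orders are recorded because \<open>noncrossing_path\<close> only compares
      an earlier step with a later one.\<close>
    then have "segments_cross (path_edge ps k) (path_edge ps l)" "segments_cross (path_edge ps l) (path_edge ps k)"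
      using k(3) l(4) by (auto simp: segments_cross_def open_segment_commute Int_commute)
    moreover have "k \<noteq> l"
      using k(2) l(2) less(1) by (metis Pair_inject less_irrefl)
    ultimately show False
      using nc k(1) l(1) by (cases k l rule: linorder_cases) (auto simp: noncrossing_path_def inner_steps_def)
  qed
  moreover have "alternating chords"
    unfolding alternating_def
  proof safe
    fix a b
    assume "(a, b) \<in> chords" "period_color a = period_color b"
    then obtain k where k: "k \<in> inner_steps" "(a, b) = chord k"
      unfolding chords_def by blast
    then have "col (ps ! k) \<noteq> col (ps ! Suc k)" "ps ! k \<in> C1" "ps ! Suc k \<in> C1"
      using alt by (auto simp: inner_steps_def successively_conv_nth)
    then show False
      by (rule_tac chord_cases[OF k(1)]; use k \<open>period_color a = period_color b\<close> color in simp)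
  qed
  moreover have "\<And>a b. (a, b) \<in> chords \<Longrightarrow> b < card C1"
    using chord_points by blast
  ultimately have "24 * card chords \<le> 23 * card C1"
    using degree_chords by (rule noncrossing_forest_card)
  moreover have "card (set ps - C1) \<le> card C2"
    using ps(2) fin by (intro card_mono) auto
  \<comment> \<open>With \<open>card C1 \<le> card chords + 1 + card C2\<close>, the forest bound
    gives \<open>card C1 \<le> 24 * (card C2 + 1)\<close>, below the assumed size.\<close>
  ultimately show False
    using card_chords assms(3) by simp
qed

end
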